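(* Let $V$ be a finite vertex set with $|V|\ge3$ and let $m=|V|-1$. Any set of $n$ distinct points of $\binom V2$ and positive weights satisfying the weighted $L_2$ Marcinkiewicz--Zygmund inequality on the $m$-dimensional space $\mathcal F_{\mathcal K}$ with distortion $0\le\varepsilon<1$ obeys $$n\ge\max\left\{m,\frac{m(m+1)(1-\varepsilon^2)}{2(1+m\varepsilon^2)}\right\}.$$ At $\varepsilon=0$, all $m(m+1)/2$ edges are necessary, and the bound is sharp (i.e. it is attained).
   Context: $\binom V2$ is the set of two-element subsets of $V$ (the edges of the complete graph $\mathcal K$ on $V$). With an arbitrary fixed ordering of the endpoints of each edge, the function space is $$\mathcal F_{\mathcal K}=\Big\{f_{\boldsymbol a}:\tbinom V2\to\mathbb R,\ f_{\boldsymbol a}(\{u,v\})=\frac{a_u-a_v}{\sqrt{|V|}}\ :\ \boldsymbol a\in\mathbb R^{|V|},\ \sum_{u\in V}a_u=0\Big\},$$ where the edge set $\binom V2$ carries the counting measure, so $\|f\|_{L_2}^2=\sum_{e\in\binom V2}|f(e)|^2$. Distinct points $x_1,\dots,x_n\in\binom V2$ and weights $w_1,\dots,w_n>0$ satisfy the weighted $L_2$ Marcinkiewicz--Zygmund inequality on $\mathcal F_{\mathcal K}$ with distortion $\varepsilon$ if $(1-\varepsilon)\|f\|_{L_2}^2\le\sum_{i=1}^nw_i|f(x_i)|^2\le(1+\varepsilon)\|f\|_{L_2}^2$ for all $f\in\mathcal F_{\mathcal K}$. *)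

theory Defs
  imports "HOL-Analysis.Analysis" "HOL-Library.Ramsey" "HOL-Library.Function_Algebras"
begin

abbreviation edges :: "'v set \<Rightarrow> 'v set set"
  where "edges V \<equiv> [V]\<^bsup>2\<^esup>"

text \<open>The fixed ordering of the endpoints: the edge \<open>e\<close> is read as the ordered pair
  \<open>(tail e, head e)\<close>.\<close>

definition endpoint_ordering :: "'v set \<Rightarrow> ('v set \<Rightarrow> 'v) \<Rightarrow> ('v set \<Rightarrow> 'v) \<Rightarrow> bool"
  where "endpoint_ordering V tail head \<longleftrightarrow> (\<forall>e\<in>edges V. e = {tail e, head e})"

text \<open>A function on \<open>edges V\<close> is represented by its extension by zero to all sets of
  vertices.\<close>

definition edge_fun ::
    "'v set \<Rightarrow> ('v set \<Rightarrow> 'v) \<Rightarrow> ('v set \<Rightarrow> 'v) \<Rightarrow> ('v \<Rightarrow> real) \<Rightarrow> 'v set \<Rightarrow> real"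
  where "edge_fun V tail head a =
    (\<lambda>e. if e \<in> edges V then (a (tail e) - a (head e)) / sqrt (real (card V)) else 0)"

definition F_complete ::
    "'v set \<Rightarrow> ('v set \<Rightarrow> 'v) \<Rightarrow> ('v set \<Rightarrow> 'v) \<Rightarrow> ('v set \<Rightarrow> real) set"
  where "F_complete V tail head = {edge_fun V tail head a | a. (\<Sum>u\<in>V. a u) = 0}"

definition fun_scale :: "real \<Rightarrow> ('x \<Rightarrow> real) \<Rightarrow> 'x \<Rightarrow> real"
  where "fun_scale c f = (\<lambda>x. c * f x)"

lemma vector_space_fun_scale: "vector_space (fun_scale :: real \<Rightarrow> ('x \<Rightarrow> real) \<Rightarrow> 'x \<Rightarrow> real)"
  by unfold_locales (auto simp: fun_scale_def fun_eq_iff algebra_simps)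

text \<open>Weighted \<open>L\<^sub>2\<close> Marcinkiewicz--Zygmund inequality with distortion \<open>\<epsilon>\<close> for a space \<open>F\<close> of
  functions on the finite set \<open>X\<close> with counting measure, so that \<open>L2_set f X\<close> is the norm of
  \<open>f\<close>.\<close>

definition weighted_MZ ::
    "'x set \<Rightarrow> ('x \<Rightarrow> real) set \<Rightarrow> nat \<Rightarrow> (nat \<Rightarrow> 'x) \<Rightarrow> (nat \<Rightarrow> real) \<Rightarrow> real \<Rightarrow> bool"
  where "weighted_MZ X F n x w \<epsilon> \<longleftrightarrow>
    x ` {1..n} \<subseteq> X \<and> inj_on x {1..n} \<and> (\<forall>i\<in>{1..n}. w i > 0) \<and>
    (\<forall>f\<in>F. (1 - \<epsilon>) * (L2_set f X)\<^sup>2 \<le> (\<Sum>i=1..n. w i * \<bar>f (x i)\<bar>\<^sup>2) \<and>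
            (\<Sum>i=1..n. w i * \<bar>f (x i)\<bar>\<^sup>2) \<le> (1 + \<epsilon>) * (L2_set f X)\<^sup>2)"

definition MZ_lower_bound :: "nat \<Rightarrow> real \<Rightarrow> real"
  where "MZ_lower_bound m \<epsilon> =
    max (real m) (real m * (real m + 1) * (1 - \<epsilon>\<^sup>2) / (2 * (1 + real m * \<epsilon>\<^sup>2)))"

end

theory Submission
  imports Defs
begin

text \<open>
  Write \<open>N = m + 1\<close> for the number of vertices. Extend the weights of the sampled edges by zero to
  \<open>\<omega>\<close> on all edges and put \<open>c = \<omega> - 1\<close>. Up to the common factor \<open>1 / N\<close>, the squared norm of an edge
  function is the Dirichlet form \<open>\<Sum>\<^sub>e (a\<^sub>u - a\<^sub>v)\<^sup>2\<close> of the complete graph, and the inequality with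
  distortion \<open>\<epsilon>\<close> says that the Dirichlet form of the signed weights \<open>c\<close> is bounded in absolute value
  by \<open>\<epsilon>\<close> times that of the complete graph. As the Laplacian of the complete graph is \<open>N\<close> times the
  orthogonal projection onto the mean-zero vectors, the Laplacian of \<open>c\<close> has operator norm at most
  \<open>\<epsilon> N\<close> there. Its column at a vertex \<open>z\<close> is its value at the indicator of \<open>z\<close>, whose mean-zero part
  has squared norm \<open>m / N\<close>, and so
    \<open>(\<Sum>\<^sub>v c\<^sub>z\<^sub>v)\<^sup>2 + \<Sum>\<^sub>v c\<^sub>z\<^sub>v\<^sup>2 \<le> \<epsilon>\<^sup>2 m N\<close>
  for every \<open>z\<close> (lemma \<open>signed_weights_row_bound\<close>). The norm bound is used through polarization of
  the form, and no spectral decomposition enters.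

  If \<open>\<epsilon> = 0\<close>, all \<open>c\<^sub>z\<^sub>v\<close> vanish, hence every edge has weight \<open>1\<close> and is sampled. In general, sum over
  \<open>z\<close>. With \<open>W = \<Sum>\<^sub>e \<omega>\<^sub>e\<close>, the Cauchy--Schwarz inequality bounds the first terms below by
  \<open>(2 W - m N)\<^sup>2 / N\<close>. The second terms add up to \<open>2 \<Sum>\<^sub>e \<omega>\<^sub>e\<^sup>2 - 4 W + m N\<close>, and
  \<open>\<Sum>\<^sub>e \<omega>\<^sub>e\<^sup>2 \<ge> W\<^sup>2 / n\<close> because only \<open>n\<close> edges carry weight. The resulting quadratic inequality in \<open>W\<close> is
  solvable only if its discriminant is nonnegative, which is the asserted lower bound on \<open>n\<close>
  (lemma \<open>quadratic_discriminant_bound\<close>).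

  The bound \<open>n \<ge> m\<close> and the dimension \<open>m\<close> come from linear algebra: a function of the space is
  determined by the values of \<open>a\<close> away from a root vertex at which \<open>a\<close> vanishes, and, since \<open>\<epsilon> < 1\<close>,
  by its values at the sampled edges. Sampling every edge with weight \<open>1\<close> attains the bound for
  \<open>\<epsilon> = 0\<close>.
\<close>

section \<open>Spaces of functions supported on a finite set\<close>

interpretation fun_space: vector_space "fun_scale :: real \<Rightarrow> ('x \<Rightarrow> real) \<Rightarrow> 'x \<Rightarrow> real"
  by (rule vector_space_fun_scale)

text \<open>The functions vanishing outside \<open>A\<close>, representing the functions on \<open>A\<close>.\<close>
definition supported_on :: "'x set \<Rightarrow> ('x \<Rightarrow> real) set"
  where "supported_on A = {f. \<forall>x. x \<notin> A \<longrightarrow> f x = 0}"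

lemma sum_fun_scale_apply: "(\<Sum>i\<in>I. fun_scale (c i) (b i)) x = (\<Sum>i\<in>I. c i * b i x)"
  by (induction I rule: infinite_finite_induct) (auto simp: fun_scale_def)

lemma inj_on_indicator_singleton: "inj_on (\<lambda>u. indicator {u} :: 'x \<Rightarrow> real) A"
  by (rule inj_onI) (metis indicator_eq_1_iff singletonD singletonI)

lemma independent_indicators:
  fixes A :: "'x set"
  assumes "finite A"
  shows "fun_space.independent ((\<lambda>u. indicator {u} :: 'x \<Rightarrow> real) ` A)"
proof (rule fun_space.independent_if_scalars_zero)
  show "finite ((\<lambda>u. indicator {u} :: 'x \<Rightarrow> real) ` A)"
    using assms by simp
next
  fix c :: "('x \<Rightarrow> real) \<Rightarrow> real" and b :: "'x \<Rightarrow> real"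
  assume zero: "(\<Sum>b\<in>(\<lambda>u. indicator {u}) ` A. fun_scale (c b) b) = 0"
    and "b \<in> (\<lambda>u. indicator {u}) ` A"
  then obtain u where u: "u \<in> A" "b = indicator {u}" by blast
  have "(\<Sum>v\<in>A. fun_scale (c (indicator {v})) (indicator {v})) = 0"
    using zero by (simp add: sum.reindex[OF inj_on_indicator_singleton])
  from fun_cong[OF this, of u] have "(\<Sum>v\<in>A. c (indicator {v}) * indicator {v} u) = 0"
    by (simp add: sum_fun_scale_apply)
  moreover have "c (indicator {v}) * indicator {v} u = (if v = u then c b else 0)" for v
    using u by (auto simp: indicator_def)
  ultimately show "c b = 0"
    using u assms by simp
qed

lemma span_indicators:
  assumes "finite A"
  shows "fun_space.span ((\<lambda>u. indicator {u}) ` A) = supported_on A"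
proof (rule fun_space.span_unique)
  show "(\<lambda>u. indicator {u}) ` A \<subseteq> supported_on A"
    by (auto simp: supported_on_def indicator_def)
  show "fun_space.subspace (supported_on A)"
    by (rule fun_space.subspaceI) (auto simp: supported_on_def fun_scale_def)
next
  fix T :: "('a \<Rightarrow> real) set"
  assume T: "(\<lambda>u. indicator {u}) ` A \<subseteq> T" "fun_space.subspace T"
  show "supported_on A \<subseteq> T"
  proof
    fix f :: "'a \<Rightarrow> real" assume f: "f \<in> supported_on A"
    have "f = (\<Sum>u\<in>A. fun_scale (f u) (indicator {u}))"
    proof
      fix x
      have "f u * indicator {u} x = (if u = x then f x else 0)" for u
        by (auto simp: indicator_def)
      then show "f x = (\<Sum>u\<in>A. fun_scale (f u) (indicator {u})) x"
        using assms f by (auto simp: sum_fun_scale_apply supported_on_def)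
    qed
    also have "\<dots> \<in> T"
      using T by (intro fun_space.subspace_sum fun_space.subspace_scale) auto
    finally show "f \<in> T" .
  qed
qed

lemma linear_fun_scaleI:
  assumes "\<And>f g. \<phi> (f + g) = \<phi> f + \<phi> g" and "\<And>c f. \<phi> (fun_scale c f) = fun_scale c (\<phi> f)"
  shows "Vector_Spaces.linear fun_scale fun_scale \<phi>"
  by (intro Vector_Spaces.linear.intro module_hom.intro module_hom_axioms.intro
      vector_space_fun_scale assms fun_space.module_axioms)

lemma dim_image_supported_on:
  assumes "finite A" and lin: "Vector_Spaces.linear fun_scale fun_scale \<phi>"
    and inj: "inj_on \<phi> (supported_on A)"
  shows "fun_space.dim (\<phi> ` supported_on A) = card A"
proof -
  interpret \<phi>: Vector_Spaces.linear fun_scale fun_scale \<phi> by (rule lin)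
  let ?D = "(\<lambda>u. indicator {u}) ` A"
  have sp: "fun_space.span ?D = supported_on A"
    by (rule span_indicators) fact
  have "fun_space.dim (\<phi> ` supported_on A) = fun_space.dim (fun_space.span (\<phi> ` ?D))"
    by (simp only: \<phi>.span_image sp)
  also have "\<dots> = card (\<phi> ` ?D)"
    using independent_indicators[OF \<open>finite A\<close>] inj
    by (intro fun_space.dim_span_eq_card_independent \<phi>.independent_injective_image) (simp_all add: sp)
  also have "\<dots> = card A"
    using inj_on_subset[OF inj, of ?D] fun_space.span_superset[of ?D] sp
    by (simp add: card_image inj_on_indicator_singleton)
  finally show ?thesis .
qed

lemma card_le_of_inj_on_supported_on:
  assumes "finite A" "finite B" and "Vector_Spaces.linear fun_scale fun_scale \<phi>"
    and "inj_on \<phi> (supported_on A)" and "\<phi> ` supported_on A \<subseteq> supported_on B"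
  shows "card A \<le> card B"
proof -
  have "card A = fun_space.dim (\<phi> ` supported_on A)"
    using assms by (simp add: dim_image_supported_on)
  also have "\<dots> \<le> card ((\<lambda>u. indicator {u} :: 'b \<Rightarrow> real) ` B)"
    using assms by (intro fun_space.dim_le_card) (simp_all add: span_indicators)
  also have "\<dots> = card B"
    by (simp add: card_image inj_on_indicator_singleton)
  finally show ?thesis .
qed

section \<open>Signed edge weights with a small Dirichlet form\<close>

text \<open>
  The entries of the column of the Laplacian of \<open>c\<close> at \<open>z\<close> are \<open>\<Sum>\<^sub>v c z v\<close> in position \<open>z\<close> and
  \<open>- c z v\<close> in the positions \<open>v \<noteq> z\<close>, so that the left-hand side is the squared norm of this column.
\<close>
lemma signed_weights_row_bound:
  fixes c :: "'v \<Rightarrow> 'v \<Rightarrow> real"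
  assumes "finite V" and z: "z \<in> V" and sym: "\<And>u v. c u v = c v u" and diag: "\<And>u. c u u = 0"
    and "0 \<le> \<epsilon>"
    and form: "\<And>a. \<bar>\<Sum>u\<in>V. \<Sum>v\<in>V. c u v * (a u - a v)\<^sup>2\<bar> \<le> \<epsilon> * (\<Sum>u\<in>V. \<Sum>v\<in>V. (a u - a v)\<^sup>2)"
  shows "(\<Sum>v\<in>V. c z v)\<^sup>2 + (\<Sum>v\<in>V. (c z v)\<^sup>2) \<le> \<epsilon>\<^sup>2 * (real (card V) - 1) * real (card V)"
proof -
  define N where "N = real (card V)"
  define s where "s = (\<Sum>v\<in>V. c z v)"
  define R where "R = s\<^sup>2 + (\<Sum>v\<in>V. (c z v)\<^sup>2)"
  define d :: "'v \<Rightarrow> real" where "d = (\<lambda>u. if u = z then 1 else 0)"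
  \<comment> \<open>\<open>y\<close> is the column at \<open>z\<close>, that is, the Laplacian applied to the indicator \<open>d\<close>.\<close>
  define y where "y = (\<lambda>u. d u * s - c z u)"
  define D where "D = (\<lambda>a b. \<Sum>u\<in>V. \<Sum>v\<in>V. c u v * (a u - a v) * (b u - b v))"
  define K where "K = (\<lambda>a :: 'v \<Rightarrow> real. \<Sum>u\<in>V. \<Sum>v\<in>V. (a u - a v)\<^sup>2)"
  have N: "N > 0"
    unfolding N_def using assms card_gt_0_iff by fastforce
  have sum_d: "(\<Sum>u\<in>V. d u * g u) = g z" for g
  proof -
    have "d u * g u = (if u = z then g z else 0)" for u
      by (simp add: d_def)
    then show ?thesis using assms by simp
  qed
  have K_eq: "K a = 2 * N * (\<Sum>u\<in>V. (a u)\<^sup>2) - 2 * (\<Sum>u\<in>V. a u)\<^sup>2" for a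
    unfolding K_def N_def power2_diff power2_eq_square[of "sum a V"] sum_product
    by (simp add: sum.distrib sum_subtractf sum_distrib_left algebra_simps)
  have sum_y: "(\<Sum>u\<in>V. y u) = 0"
    using sum_d[of "\<lambda>_. s"] by (simp add: y_def sum_subtractf s_def)
  have "(y u)\<^sup>2 = d u * (s\<^sup>2 - 2 * s * c z u) + (c z u)\<^sup>2" for u
    by (auto simp: y_def d_def power2_eq_square algebra_simps)
  then have sum_y2: "(\<Sum>u\<in>V. (y u)\<^sup>2) = R"
    using sum_d[of "\<lambda>u. s\<^sup>2 - 2 * s * c z u"] by (simp add: sum.distrib R_def diag)
  have Kd: "K d = 2 * (N - 1)"
  proof -
    have "(\<Sum>u\<in>V. (d u)\<^sup>2) = 1" "(\<Sum>u\<in>V. d u) = 1"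
      using sum_d[of d] sum_d[of "\<lambda>_. 1"] by (simp_all add: power2_eq_square d_def)
    then show ?thesis by (simp add: K_eq)
  qed
  have Ky: "K y = 2 * N * R"
    by (simp add: K_eq sum_y sum_y2)
  have Ddy: "D d y = 2 * R"
  proof -
    have "D d y = (\<Sum>u\<in>V. d u * (\<Sum>v\<in>V. c u v * (y u - y v)))
        - (\<Sum>u\<in>V. \<Sum>v\<in>V. d v * (c u v * (y u - y v)))"
      unfolding D_def sum_subtractf[symmetric] sum_distrib_left
      by (intro sum.cong refl) (simp add: algebra_simps)
    also have "(\<Sum>u\<in>V. \<Sum>v\<in>V. d v * (c u v * (y u - y v)))
        = (\<Sum>u\<in>V. c u z * (y u - y z))"
      by (simp only: sum_d)
    also have "\<dots> = - (\<Sum>v\<in>V. c z v * (y z - y v))"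
      unfolding sum_negf[symmetric] by (intro sum.cong refl) (simp add: sym[of _ z] algebra_simps)
    finally have "D d y = 2 * (\<Sum>v\<in>V. c z v * (y z - y v))"
      by (simp add: sum_d)
    also have "(\<Sum>v\<in>V. c z v * (y z - y v)) = (\<Sum>v\<in>V. s * c z v + (c z v)\<^sup>2)"
      by (intro sum.cong refl) (auto simp: y_def d_def diag power2_eq_square algebra_simps)
    also have "\<dots> = R"
      by (simp add: sum.distrib R_def s_def power2_eq_square sum_distrib_left)
    finally show ?thesis .
  qed
  have DK: "\<bar>D a a\<bar> \<le> \<epsilon> * K a" for a
    using form[of a] by (simp add: D_def K_def power2_eq_square mult.assoc)
  \<comment> \<open>Polarization: compare the form at \<open>d + t y\<close> and at \<open>d - t y\<close>.\<close>
  have key: "2 * t * R \<le> \<epsilon> * ((N - 1) + t\<^sup>2 * N * R)" for t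
  proof -
    let ?p = "\<lambda>u. d u + t * y u" and ?q = "\<lambda>u. d u - t * y u"
    have "D ?p ?p - D ?q ?q = 4 * t * D d y"
      unfolding D_def by (simp add: sum_subtractf[symmetric] sum_distrib_left algebra_simps)
    moreover have "K ?p + K ?q = 2 * K d + 2 * t\<^sup>2 * K y"
      unfolding K_def
      by (simp add: sum.distrib[symmetric] sum_distrib_left power2_eq_square algebra_simps)
    then have "\<epsilon> * K ?p + \<epsilon> * K ?q = \<epsilon> * (2 * K d + 2 * t\<^sup>2 * K y)"
      by (metis distrib_left)
    ultimately have "4 * t * D d y \<le> \<epsilon> * (2 * K d + 2 * t\<^sup>2 * K y)"
      using DK[of ?p] DK[of ?q] by linarith
    then show ?thesis
      by (simp add: Kd Ky Ddy algebra_simps)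
  qed
  have "R \<le> \<epsilon>\<^sup>2 * (N - 1) * N"
  proof (cases "\<epsilon> = 0")
    case True
    then show ?thesis using key[of 1] by simp
  next
    case False
    \<comment> \<open>This choice makes the term quadratic in \<open>t\<close> half of the left-hand side.\<close>
    define t where "t = 1 / (\<epsilon> * N)"
    have t: "\<epsilon> * N * t = 1" "\<epsilon> * N > 0"
      using False N \<open>0 \<le> \<epsilon>\<close> by (simp_all add: t_def)
    have "2 * t * R \<le> \<epsilon> * (N - 1) + (\<epsilon> * N * t) * t * R"
      using key[of t] by (simp add: power2_eq_square algebra_simps)
    then have "t * R \<le> \<epsilon> * (N - 1)"
      unfolding t(1) by linarith
    then have "\<epsilon> * N * (t * R) \<le> \<epsilon> * N * (\<epsilon> * (N - 1))"
      using t(2) by (intro mult_left_mono) simp_all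
    then have "(\<epsilon> * N * t) * R \<le> \<epsilon> * N * (\<epsilon> * (N - 1))"
      by (simp only: mult.assoc)
    then show ?thesis
      unfolding t(1) by (simp add: power2_eq_square mult_ac)
  qed
  then show ?thesis
    by (simp add: R_def s_def N_def)
qed

lemma sum_pairs_eq_sum_edges:
  fixes G :: "'v set \<Rightarrow> real"
  assumes "finite V"
  shows "(\<Sum>u\<in>V. \<Sum>v\<in>V. if u = v then 0 else G {u, v}) = 2 * (\<Sum>e\<in>edges V. G e)"
proof -
  let ?P = "{p \<in> V \<times> V. fst p \<noteq> snd p}" and ?g = "\<lambda>p. {fst p, snd p}"
  have "(\<Sum>u\<in>V. \<Sum>v\<in>V. if u = v then 0 else G {u, v})
      = (\<Sum>p\<in>V \<times> V. if fst p = snd p then 0 else G (?g p))"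
    by (simp add: sum.cartesian_product case_prod_unfold)
  also have "\<dots> = (\<Sum>p\<in>?P. G (?g p))"
    using assms by (intro sum.mono_neutral_cong_right) auto
  also have "\<dots> = (\<Sum>e\<in>edges V. \<Sum>p\<in>{p \<in> ?P. ?g p = e}. G (?g p))"
    using assms by (intro sum.group[symmetric] finite_imp_finite_nsets) auto
  also have "\<dots> = (\<Sum>e\<in>edges V. 2 * G e)"
  proof (rule sum.cong[OF refl])
    fix e assume "e \<in> edges V"
    then obtain a b where ab: "e = {a, b}" "a \<in> V" "b \<in> V" "a \<noteq> b"
      by (rule nsets2_E)
    then have "{p \<in> ?P. ?g p = e} = {(a, b), (b, a)}"
      by (auto simp: doubleton_eq_iff)
    then show "(\<Sum>p\<in>{p \<in> ?P. ?g p = e}. G (?g p)) = 2 * G e"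
      using ab by (simp add: insert_commute)
  qed
  finally show ?thesis
    by (simp add: sum_distrib_left)
qed


section \<open>The space of edge functions of the complete graph\<close>

lemma edge_fun_sq:
  assumes "endpoint_ordering V tail head" "u \<in> V" "v \<in> V" "u \<noteq> v"
  shows "(edge_fun V tail head a {u, v})\<^sup>2 = (a u - a v)\<^sup>2 / real (card V)"
proof -
  have "{u, v} = {tail {u, v}, head {u, v}}"
    using assms by (simp add: endpoint_ordering_def)
  then have "(a (tail {u, v}) - a (head {u, v}))\<^sup>2 = (a u - a v)\<^sup>2"
    by (metis doubleton_eq_iff power2_commute)
  then show ?thesis
    using assms by (simp add: edge_fun_def power_divide)
qed

lemma endpoints_in_V:
  assumes "endpoint_ordering V tail head" "e \<in> edges V"
  shows "tail e \<in> V" "head e \<in> V"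
proof -
  have "e = {tail e, head e}" "e \<subseteq> V"
    using assms by (auto simp: endpoint_ordering_def nsets_def)
  then show "tail e \<in> V" "head e \<in> V" by blast+
qed

lemma edge_fun_cong_shift:
  assumes "endpoint_ordering V tail head" and "\<And>u. u \<in> V \<Longrightarrow> b u = a u + k"
  shows "edge_fun V tail head b = edge_fun V tail head a"
  using assms by (auto simp: edge_fun_def fun_eq_iff endpoints_in_V)

text \<open>
  Edge functions depend on differences only, so the condition that \<open>a\<close> has mean zero restricts nothing.
\<close>
lemma edge_fun_in_F_complete:
  assumes "endpoint_ordering V tail head" and "finite V" "V \<noteq> {}"
  shows "edge_fun V tail head a \<in> F_complete V tail head"
proof -
  define k where "k = (\<Sum>u\<in>V. a u) / real (card V)"
  have "(\<Sum>u\<in>V. a u - k) = 0"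
    using assms by (simp add: k_def sum_subtractf)
  moreover have "edge_fun V tail head (\<lambda>u. a u - k) = edge_fun V tail head a"
    using assms(1) by (rule edge_fun_cong_shift[where k = "- k"]) simp
  ultimately show ?thesis
    unfolding F_complete_def by (metis (mono_tags, lifting) mem_Collect_eq)
qed

text \<open>
  Instead of the mean, the value at a root vertex \<open>r\<close> can be normalized to zero. With this choice the
  space is parametrized by functions supported on \<open>V - {r}\<close>.
\<close>
lemma F_complete_eq_image:
  assumes "endpoint_ordering V tail head" and "finite V" "r \<in> V"
  shows "F_complete V tail head = edge_fun V tail head ` supported_on (V - {r})"
proof
  show "edge_fun V tail head ` supported_on (V - {r}) \<subseteq> F_complete V tail head"
    using assms edge_fun_in_F_complete by blast
  show "F_complete V tail head \<subseteq> edge_fun V tail head ` supported_on (V - {r})"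
  proof
    fix f assume "f \<in> F_complete V tail head"
    then obtain a where f: "f = edge_fun V tail head a"
      by (auto simp: F_complete_def)
    define b where "b = (\<lambda>u. if u \<in> V then a u - a r else 0)"
    have "b \<in> supported_on (V - {r})"
      by (auto simp: b_def supported_on_def)
    moreover have "edge_fun V tail head b = f"
      unfolding f using assms(1) by (rule edge_fun_cong_shift[where k = "- a r"]) (simp add: b_def)
    ultimately show "f \<in> edge_fun V tail head ` supported_on (V - {r})"
      by blast
  qed
qed

lemma linear_edge_fun: "Vector_Spaces.linear fun_scale fun_scale (edge_fun V tail head)"
  by (rule linear_fun_scaleI)
    (auto simp: edge_fun_def fun_scale_def fun_eq_iff add_divide_distrib diff_divide_distrib algebra_simps)

lemma subspace_supported_on: "finite A \<Longrightarrow> fun_space.subspace (supported_on A)"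
  by (metis span_indicators fun_space.subspace_span)

lemma edge_fun_eq_0D:
  assumes "endpoint_ordering V tail head" and "finite V" "r \<in> V" and "a \<in> supported_on (V - {r})"
    and zero: "\<And>e. e \<in> edges V \<Longrightarrow> edge_fun V tail head a e = 0"
  shows "a = 0"
proof
  fix u
  have ar: "a r = 0" using assms by (simp add: supported_on_def)
  show "a u = 0 u"
  proof (cases "u \<in> V - {r}")
    case True
    then have "(a u - a r)\<^sup>2 / real (card V) = 0"
      using assms(1,3) zero[of "{u, r}"] edge_fun_sq[of V tail head u r a] by simp
    moreover have "card V \<noteq> 0"
      using assms by auto
    ultimately show ?thesis using ar by simp
  next
    case False
    then show ?thesis using assms by (simp add: supported_on_def)
  qed
qed

lemma inj_on_edge_fun:
  assumes "endpoint_ordering V tail head" and "finite V" "r \<in> V"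
  shows "inj_on (edge_fun V tail head) (supported_on (V - {r}))"
proof -
  interpret \<phi>: Vector_Spaces.linear fun_scale fun_scale "edge_fun V tail head"
    by (rule linear_edge_fun)
  show ?thesis
    using assms by (subst \<phi>.inj_on_iff_eq_0)
      (auto intro!: subspace_supported_on edge_fun_eq_0D[of V tail head r])
qed

section \<open>Marcinkiewicz--Zygmund inequalities as bounds for signed weights\<close>

text \<open>
  The list of sampled points and weights becomes one weight function \<open>\<omega>\<close> on the whole domain, zero at
  the points that are not sampled.
\<close>
lemma weighted_MZ_edge_weights:
  assumes "weighted_MZ X F n x w \<epsilon>" and "finite X"
  shows "\<exists>\<omega>. (\<forall>e. e \<notin> x ` {1..n} \<longrightarrow> \<omega> e = 0) \<and>
    (\<forall>f\<in>F. \<bar>\<Sum>e\<in>X. (\<omega> e - 1) * (f e)\<^sup>2\<bar> \<le> \<epsilon> * (\<Sum>e\<in>X. (f e)\<^sup>2))"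
proof -
  define \<omega> where "\<omega> e = (if e \<in> x ` {1..n} then w (the_inv_into {1..n} x e) else 0)" for e
  have sub: "x ` {1..n} \<subseteq> X" and inj: "inj_on x {1..n}"
    using assms by (auto simp: weighted_MZ_def)
  have \<omega>x: "\<omega> (x i) = w i" if "i \<in> {1..n}" for i
    using that inj by (simp add: \<omega>_def the_inv_into_f_f)
  have "\<bar>\<Sum>e\<in>X. (\<omega> e - 1) * (f e)\<^sup>2\<bar> \<le> \<epsilon> * (\<Sum>e\<in>X. (f e)\<^sup>2)" if f: "f \<in> F" for f
  proof -
    have "(\<Sum>i=1..n. w i * \<bar>f (x i)\<bar>\<^sup>2) = (\<Sum>i=1..n. \<omega> (x i) * (f (x i))\<^sup>2)"
      by (intro sum.cong refl) (simp add: \<omega>x)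
    also have "\<dots> = (\<Sum>e\<in>x ` {1..n}. \<omega> e * (f e)\<^sup>2)"
      using inj by (simp add: sum.reindex)
    also have "\<dots> = (\<Sum>e\<in>X. \<omega> e * (f e)\<^sup>2)"
      using sub assms(2) by (intro sum.mono_neutral_left) (auto simp: \<omega>_def)
    finally have *: "(\<Sum>i=1..n. w i * \<bar>f (x i)\<bar>\<^sup>2) = (\<Sum>e\<in>X. \<omega> e * (f e)\<^sup>2)" .
    have "(L2_set f X)\<^sup>2 = (\<Sum>e\<in>X. (f e)\<^sup>2)"
      by (simp add: L2_set_def sum_nonneg)
    then have "(1 - \<epsilon>) * (\<Sum>e\<in>X. (f e)\<^sup>2) \<le> (\<Sum>e\<in>X. \<omega> e * (f e)\<^sup>2)"
      and "(\<Sum>e\<in>X. \<omega> e * (f e)\<^sup>2) \<le> (1 + \<epsilon>) * (\<Sum>e\<in>X. (f e)\<^sup>2)"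
      using assms(1) f * by (auto simp: weighted_MZ_def)
    then show ?thesis
      by (simp add: left_diff_distrib distrib_right sum_subtractf abs_le_iff)
  qed
  moreover have "\<omega> e = 0" if "e \<notin> x ` {1..n}" for e
    using that by (simp add: \<omega>_def)
  ultimately show ?thesis by blast
qed

lemma sum_edge_fun_sq_eq:
  assumes "endpoint_ordering V tail head" and "finite V"
  shows "(\<Sum>u\<in>V. \<Sum>v\<in>V. (if u = v then 0 else g {u, v}) * (a u - a v)\<^sup>2)
    = 2 * real (card V) * (\<Sum>e\<in>edges V. g e * (edge_fun V tail head a e)\<^sup>2)"
proof -
  have "(\<Sum>u\<in>V. \<Sum>v\<in>V. (if u = v then 0 else g {u, v}) * (a u - a v)\<^sup>2)
      = (\<Sum>u\<in>V. \<Sum>v\<in>V. if u = v then 0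
          else real (card V) * (g {u, v} * (edge_fun V tail head a {u, v})\<^sup>2))"
    using assms by (intro sum.cong refl) (auto simp: edge_fun_sq)
  then show ?thesis
    using sum_pairs_eq_sum_edges[OF assms(2),
        of "\<lambda>e. real (card V) * (g e * (edge_fun V tail head a e)\<^sup>2)"]
    by (simp add: sum_distrib_left mult.assoc)
qed

text \<open>
  Used with \<open>g = \<omega> - 1\<close>. The diagonal is set to zero because singletons are not edges.
\<close>
lemma edge_weights_row_bound:
  assumes "endpoint_ordering V tail head" and "finite V" "z \<in> V" and "0 \<le> \<epsilon>"
    and MZ: "\<And>f. f \<in> F_complete V tail head \<Longrightarrow>
      \<bar>\<Sum>e\<in>edges V. g e * (f e)\<^sup>2\<bar> \<le> \<epsilon> * (\<Sum>e\<in>edges V. (f e)\<^sup>2)"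
  shows "(\<Sum>v\<in>V. if z = v then 0 else g {z, v})\<^sup>2 + (\<Sum>v\<in>V. (if z = v then 0 else g {z, v})\<^sup>2)
    \<le> \<epsilon>\<^sup>2 * (real (card V) - 1) * real (card V)"
proof (rule signed_weights_row_bound[where c = "\<lambda>u v. if u = v then 0 else g {u, v}"])
  fix a :: "'a \<Rightarrow> real"
  let ?f = "edge_fun V tail head a"
  have "?f \<in> F_complete V tail head"
    using assms by (intro edge_fun_in_F_complete) auto
  from mult_left_mono[OF MZ[OF this], of "2 * real (card V)"]
  have "\<bar>2 * real (card V) * (\<Sum>e\<in>edges V. g e * (?f e)\<^sup>2)\<bar>
      \<le> \<epsilon> * (2 * real (card V) * (\<Sum>e\<in>edges V. 1 * (?f e)\<^sup>2))"
    by (simp add: abs_mult algebra_simps)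
  then have "\<bar>\<Sum>u\<in>V. \<Sum>v\<in>V. (if u = v then 0 else g {u, v}) * (a u - a v)\<^sup>2\<bar>
      \<le> \<epsilon> * (\<Sum>u\<in>V. \<Sum>v\<in>V. (if u = v then 0 else 1) * (a u - a v)\<^sup>2)"
    unfolding sum_edge_fun_sq_eq[OF assms(1,2), symmetric] .
  moreover have "(if u = v then 0 else 1) * (a u - a v)\<^sup>2 = (a u - a v)\<^sup>2" for u v
    by simp
  ultimately show "\<bar>\<Sum>u\<in>V. \<Sum>v\<in>V. (if u = v then 0 else g {u, v}) * (a u - a v)\<^sup>2\<bar>
      \<le> \<epsilon> * (\<Sum>u\<in>V. \<Sum>v\<in>V. (a u - a v)\<^sup>2)"
    by (simp only:)
qed (use assms in \<open>auto simp: insert_commute\<close>)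

section \<open>Lower bounds on the number of sampled edges\<close>

lemma card_edges:
  assumes "finite V" "card V = m + 1"
  shows "real (card (edges V)) = real m * (real m + 1) / 2"
proof -
  have "2 * (card V choose 2) = card V * (card V - 1)"
    using assms by (simp add: choose_two)
  then have "2 * card (edges V) = (m + 1) * m"
    using assms by (simp add: card_nsets)
  then have "2 * real (card (edges V)) = real ((m + 1) * m)"
    by (metis of_nat_mult of_nat_numeral)
  then show ?thesis
    by (simp add: algebra_simps)
qed

text \<open>
  In the application \<open>W\<close> is the total weight and \<open>n\<close> the number of sampled edges, on a graph with
  \<open>m + 1\<close> vertices.
\<close>
lemma quadratic_discriminant_bound:
  fixes W m n \<epsilon> :: real
  assumes "0 < m" "0 < n"
    and "(2 * W - m * (m + 1))\<^sup>2 / (m + 1) + 2 * W\<^sup>2 / n - 4 * W + m * (m + 1)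
      \<le> \<epsilon>\<^sup>2 * m * (m + 1)\<^sup>2"
  shows "m * (m + 1) * (1 - \<epsilon>\<^sup>2) / (2 * (1 + m * \<epsilon>\<^sup>2)) \<le> n"
proof -
  define T N where "T = 2 * W" and "N = m + 1"
  define \<alpha> where "\<alpha> = 1 / N + 1 / (2 * n)"
  have N: "N > 0" and \<alpha>: "\<alpha> > 0"
    using assms by (simp_all add: N_def \<alpha>_def add_pos_pos)
  have "(T - m * N)\<^sup>2 / N + T\<^sup>2 / (2 * n) - 2 * T + m * N \<le> \<epsilon>\<^sup>2 * m * N\<^sup>2"
    using assms(3) by (simp add: T_def N_def power_mult_distrib)
  moreover have "(T - m * N)\<^sup>2 / N = T\<^sup>2 / N - 2 * m * T + m * m * N"
    using N by (simp add: power2_eq_square field_simps)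
  moreover have "\<alpha> * T\<^sup>2 = T\<^sup>2 / N + T\<^sup>2 / (2 * n)"
    by (simp add: \<alpha>_def distrib_right)
  moreover have "2 * N * T = 2 * m * T + 2 * T"
    and "m * (1 - \<epsilon>\<^sup>2) * N\<^sup>2 = m * m * N + m * N - \<epsilon>\<^sup>2 * m * N\<^sup>2"
    by (simp_all add: N_def power2_eq_square algebra_simps)
  ultimately have "\<alpha> * T\<^sup>2 - 2 * N * T \<le> - (m * (1 - \<epsilon>\<^sup>2) * N\<^sup>2)"
    by linarith
  \<comment> \<open>Complete the square in \<open>\<alpha> T - N\<close>.\<close>
  from mult_left_mono[OF this, of \<alpha>]
  have "\<alpha> * (m * (1 - \<epsilon>\<^sup>2)) * N\<^sup>2 \<le> 2 * N * (\<alpha> * T) - (\<alpha> * T)\<^sup>2"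
    using \<alpha> by (simp add: power2_eq_square algebra_simps)
  also have "\<dots> \<le> 1 * N\<^sup>2"
    using zero_le_power2[of "\<alpha> * T - N"] by (simp add: power2_diff algebra_simps)
  finally have "\<alpha> * (m * (1 - \<epsilon>\<^sup>2)) \<le> 1"
    using N by simp
  then have "(N + 2 * n) * (m * (1 - \<epsilon>\<^sup>2)) \<le> 2 * n * N"
    using N assms by (simp add: \<alpha>_def field_simps)
  moreover have "1 + m * \<epsilon>\<^sup>2 > 0"
    using assms by (simp add: add_pos_nonneg)
  ultimately show ?thesis
    by (simp add: N_def field_simps)
qed

text \<open>
  If the distortion is less than \<open>1\<close>, restriction to the edges carrying weight is injective on the
  space.
\<close>
lemma edge_weights_card_ge:
  assumes ord: "endpoint_ordering V tail head" and V: "finite V" "r \<in> V"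
    and \<epsilon>: "\<epsilon> < 1" and E: "finite E" and \<omega>0: "\<And>e. e \<notin> E \<Longrightarrow> \<omega> e = 0"
    and \<omega>: "\<And>f. f \<in> F_complete V tail head \<Longrightarrow>
      \<bar>\<Sum>e\<in>edges V. (\<omega> e - 1) * (f e)\<^sup>2\<bar> \<le> \<epsilon> * (\<Sum>e\<in>edges V. (f e)\<^sup>2)"
  shows "card (V - {r}) \<le> card E"
proof -
  have finE: "finite (edges V)"
    using V by (simp add: finite_imp_finite_nsets)
  define \<phi> where "\<phi> a = (\<lambda>e. if e \<in> E then edge_fun V tail head a e else 0)" for a
  have lin: "Vector_Spaces.linear fun_scale fun_scale \<phi>"
    using linear_edge_fun[of V tail head]
    by (intro linear_fun_scaleI)
      (auto simp: \<phi>_def fun_eq_iff edge_fun_def fun_scale_def add_divide_distrib diff_divide_distrib algebra_simps)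
  interpret \<phi>: Vector_Spaces.linear fun_scale fun_scale \<phi> by (rule lin)
  have "inj_on \<phi> (supported_on (V - {r}))"
  proof (subst \<phi>.inj_on_iff_eq_0)
    show "fun_space.subspace (supported_on (V - {r}))"
      using V by (simp add: subspace_supported_on)
    show "\<forall>a\<in>supported_on (V - {r}). \<phi> a = 0 \<longrightarrow> a = 0"
    proof (intro ballI impI)
      fix a assume a: "a \<in> supported_on (V - {r})" and zero: "\<phi> a = 0"
      let ?f = "edge_fun V tail head a" and ?S = "\<Sum>e\<in>edges V. (edge_fun V tail head a e)\<^sup>2"
      have "\<omega> e * (?f e)\<^sup>2 = 0" for e
        using fun_cong[OF zero, of e] \<omega>0[of e] by (auto simp: \<phi>_def split: if_splits)
      then have "(\<Sum>e\<in>edges V. (\<omega> e - 1) * (?f e)\<^sup>2) = - ?S"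
        by (simp only: left_diff_distrib sum_negf[symmetric] diff_0 mult_1)
      moreover have "?S \<ge> 0"
        by (simp add: sum_nonneg)
      ultimately have "?S \<le> \<epsilon> * ?S"
        using \<omega>[of ?f] edge_fun_in_F_complete[OF ord V(1), of a] V(2) by auto
      then have "?S = 0"
        using \<epsilon> \<open>?S \<ge> 0\<close> mult_strict_right_mono[of \<epsilon> 1 ?S] by fastforce
      then have "?f e = 0" if "e \<in> edges V" for e
        using that finE by (simp add: sum_nonneg_eq_0_iff)
      then show "a = 0"
        using edge_fun_eq_0D[OF ord V a] by blast
    qed
  qed
  moreover have "\<phi> ` supported_on (V - {r}) \<subseteq> supported_on E"
    by (auto simp: \<phi>_def supported_on_def)
  ultimately show ?thesis
    using V E lin by (intro card_le_of_inj_on_supported_on) simp_all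
qed

lemma weighted_MZ_complete_lower_bound:
  assumes ord: "endpoint_ordering V tail head" and V: "finite V" "card V = m + 1" and "1 \<le> m"
    and \<epsilon>: "0 \<le> \<epsilon>" "\<epsilon> < 1"
    and MZ: "weighted_MZ (edges V) (F_complete V tail head) n x w \<epsilon>"
  shows "MZ_lower_bound m \<epsilon> \<le> real n"
proof -
  let ?E = "x ` {1..n}"
  have finE: "finite (edges V)"
    using V by (simp add: finite_imp_finite_nsets)
  have sub: "?E \<subseteq> edges V" and cardE: "card ?E = n"
    using MZ by (auto simp: weighted_MZ_def card_image)
  obtain \<omega> where \<omega>0: "\<And>e. e \<notin> ?E \<Longrightarrow> \<omega> e = 0"
    and \<omega>: "\<And>f. f \<in> F_complete V tail head \<Longrightarrow>
      \<bar>\<Sum>e\<in>edges V. (\<omega> e - 1) * (f e)\<^sup>2\<bar> \<le> \<epsilon> * (\<Sum>e\<in>edges V. (f e)\<^sup>2)"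
    using weighted_MZ_edge_weights[OF MZ finE] by blast
  obtain r where r: "r \<in> V"
    using V by fastforce
  have "card (V - {r}) \<le> card ?E"
    by (rule edge_weights_card_ge[OF ord V(1) r \<epsilon>(2) _ \<omega>0 \<omega>]) simp_all
  then have mn: "m \<le> n"
    using V r cardE by simp
  define M where "M = real m"
  define c where "c u v = (if u = v then 0 else \<omega> {u, v} - 1)" for u v
  define W where "W = (\<Sum>e\<in>edges V. \<omega> e)"
  define Q where "Q = (\<Sum>e\<in>edges V. (\<omega> e)\<^sup>2)"
  have cE: "2 * real (card (edges V)) = M * (M + 1)"
    using card_edges[OF V] by (simp add: M_def)
  have sum_c: "(\<Sum>u\<in>V. \<Sum>v\<in>V. c u v) = 2 * W - M * (M + 1)"
    using sum_pairs_eq_sum_edges[OF V(1), of "\<lambda>e. \<omega> e - 1"] cE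
    by (simp add: c_def W_def sum_subtractf)
  have "(\<Sum>u\<in>V. \<Sum>v\<in>V. (c u v)\<^sup>2) = (\<Sum>u\<in>V. \<Sum>v\<in>V. if u = v then 0 else (\<omega> {u, v} - 1)\<^sup>2)"
    by (intro sum.cong refl) (simp add: c_def)
  also have "\<dots> = 2 * Q - 4 * W + M * (M + 1)"
    using sum_pairs_eq_sum_edges[OF V(1), of "\<lambda>e. (\<omega> e - 1)\<^sup>2"] cE
    by (simp add: Q_def W_def power2_diff sum.distrib sum_subtractf sum_distrib_left[symmetric])
  finally have sum_c2: "(\<Sum>u\<in>V. \<Sum>v\<in>V. (c u v)\<^sup>2) = 2 * Q - 4 * W + M * (M + 1)" .
  have "(\<Sum>v\<in>V. c z v)\<^sup>2 + (\<Sum>v\<in>V. (c z v)\<^sup>2) \<le> \<epsilon>\<^sup>2 * M * (M + 1)" if "z \<in> V" for z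
    using edge_weights_row_bound[OF ord V(1) that \<epsilon>(1) \<omega>] V by (simp add: c_def M_def algebra_simps)
  then have "(\<Sum>z\<in>V. (\<Sum>v\<in>V. c z v)\<^sup>2 + (\<Sum>v\<in>V. (c z v)\<^sup>2)) \<le> (\<Sum>z\<in>V. \<epsilon>\<^sup>2 * M * (M + 1))"
    by (rule sum_mono)
  then have rows: "(\<Sum>z\<in>V. (\<Sum>v\<in>V. c z v)\<^sup>2) + (2 * Q - 4 * W + M * (M + 1)) \<le> \<epsilon>\<^sup>2 * M * (M + 1)\<^sup>2"
    using V sum_c2 by (simp add: sum.distrib M_def power2_eq_square algebra_simps)
  have "(2 * W - M * (M + 1))\<^sup>2 \<le> (\<Sum>z\<in>V. (\<Sum>v\<in>V. c z v)\<^sup>2) * (M + 1)"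
    using sum_squared_le_sum_of_squares[of "\<lambda>z. \<Sum>v\<in>V. c z v" V] V by (simp add: sum_c M_def algebra_simps)
  then have CS1: "(2 * W - M * (M + 1))\<^sup>2 / (M + 1) \<le> (\<Sum>z\<in>V. (\<Sum>v\<in>V. c z v)\<^sup>2)"
    by (simp add: M_def pos_divide_le_eq)
  \<comment> \<open>The weight sits on \<open>n\<close> edges only.\<close>
  have "W = (\<Sum>e\<in>?E. \<omega> e)" "Q = (\<Sum>e\<in>?E. (\<omega> e)\<^sup>2)"
    unfolding W_def Q_def using finE sub \<omega>0 by (auto intro!: sum.mono_neutral_right)
  then have "W\<^sup>2 \<le> Q * real n"
    using sum_squared_le_sum_of_squares[of \<omega> ?E] cardE by simp
  then have CS2: "2 * W\<^sup>2 / real n \<le> 2 * Q"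
    using mn \<open>1 \<le> m\<close> by (simp add: pos_divide_le_eq)
  have "M * (M + 1) * (1 - \<epsilon>\<^sup>2) / (2 * (1 + M * \<epsilon>\<^sup>2)) \<le> real n"
    using rows CS1 CS2 mn \<open>1 \<le> m\<close>
    by (intro quadratic_discriminant_bound[of M "real n" W]) (simp_all add: M_def)
  then show ?thesis
    using mn by (simp add: MZ_lower_bound_def M_def)
qed

lemma weighted_MZ_complete_exact_all_edges:
  assumes ord: "endpoint_ordering V tail head" and V: "finite V"
    and MZ: "weighted_MZ (edges V) (F_complete V tail head) n x w 0"
  shows "x ` {1..n} = edges V"
proof
  show "x ` {1..n} \<subseteq> edges V"
    using MZ by (simp add: weighted_MZ_def)
  obtain \<omega> where \<omega>0: "\<And>e. e \<notin> x ` {1..n} \<Longrightarrow> \<omega> e = 0"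
    and \<omega>: "\<And>f. f \<in> F_complete V tail head \<Longrightarrow>
      \<bar>\<Sum>e\<in>edges V. (\<omega> e - 1) * (f e)\<^sup>2\<bar> \<le> 0 * (\<Sum>e\<in>edges V. (f e)\<^sup>2)"
    using weighted_MZ_edge_weights[OF MZ finite_imp_finite_nsets[OF V]] by blast
  show "edges V \<subseteq> x ` {1..n}"
  proof
    fix e assume "e \<in> edges V"
    then obtain u v where e: "e = {u, v}" "u \<in> V" "v \<in> V" "u \<noteq> v"
      by (rule nsets2_E)
    let ?c = "\<lambda>v. if u = v then 0 else \<omega> {u, v} - 1"
    have "(\<Sum>v\<in>V. ?c v)\<^sup>2 + (\<Sum>v\<in>V. (?c v)\<^sup>2) \<le> 0"
      using edge_weights_row_bound[OF ord V e(2) order_refl \<omega>] by simp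
    then have "(\<Sum>v\<in>V. (?c v)\<^sup>2) = 0"
      by (smt (verit) sum_nonneg zero_le_power2)
    then have "(?c v)\<^sup>2 = 0"
      using V e by (subst (asm) sum_nonneg_eq_0_iff) auto
    then have "\<omega> e = 1"
      using e by simp
    then show "e \<in> x ` {1..n}"
      using \<omega>0[of e] by (metis zero_neq_one)
  qed
qed

theorem corollary4p5:
  fixes V :: "'v set" and tail head :: "'v set \<Rightarrow> 'v" and m :: nat
  assumes "finite V" and "card V \<ge> 3" and "m = card V - 1"
    and "endpoint_ordering V tail head"
  shows "module.subspace fun_scale (F_complete V tail head) \<and>
    vector_space.dim fun_scale (F_complete V tail head) = m \<and>
    (\<forall>n x w \<epsilon>. 0 \<le> \<epsilon> \<and> \<epsilon> < 1 \<and> weighted_MZ (edges V) (F_complete V tail head) n x w \<epsilon>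
       \<longrightarrow> real n \<ge> MZ_lower_bound m \<epsilon>) \<and>
    (\<forall>n x w. weighted_MZ (edges V) (F_complete V tail head) n x w 0
       \<longrightarrow> x ` {1..n} = edges V) \<and>
    real (card (edges V)) = real m * (real m + 1) / 2 \<and>
    (\<exists>n x w. weighted_MZ (edges V) (F_complete V tail head) n x w 0
       \<and> real n = MZ_lower_bound m 0)"
proof (intro conjI allI impI)
  have cV: "card V = m + 1" and m: "2 \<le> m"
    using assms by auto
  obtain r where r: "r \<in> V"
    using cV by fastforce
  note F_eq = F_complete_eq_image[OF assms(4,1) r]
  interpret \<phi>: Vector_Spaces.linear fun_scale fun_scale "edge_fun V tail head"
    by (rule linear_edge_fun)
  show "module.subspace fun_scale (F_complete V tail head)"
    unfolding F_eq using assms(1) by (intro \<phi>.subspace_image subspace_supported_on) simp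
  show "vector_space.dim fun_scale (F_complete V tail head) = m"
    unfolding F_eq using assms(1) r cV
    by (subst dim_image_supported_on[OF _ linear_edge_fun inj_on_edge_fun[OF assms(4,1) r]]) simp_all
  show "MZ_lower_bound m \<epsilon> \<le> real n"
    if "0 \<le> \<epsilon> \<and> \<epsilon> < 1 \<and> weighted_MZ (edges V) (F_complete V tail head) n x w \<epsilon>" for n x w \<epsilon>
    using that m weighted_MZ_complete_lower_bound[OF assms(4,1) cV] by auto
  show "x ` {1..n} = edges V"
    if "weighted_MZ (edges V) (F_complete V tail head) n x w 0" for n x w
    using weighted_MZ_complete_exact_all_edges[OF assms(4,1) that] .
  show card: "real (card (edges V)) = real m * (real m + 1) / 2"
    by (rule card_edges[OF assms(1) cV])
  show "\<exists>n x w. weighted_MZ (edges V) (F_complete V tail head) n x w 0 \<and> real n = MZ_lower_bound m 0"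
  proof -
    let ?n = "card (edges V)"
    obtain x where x: "bij_betw x {1..?n} (edges V)"
      using ex_bij_betw_nat_finite_1[OF finite_imp_finite_nsets[OF assms(1)]] by blast
    have "(\<Sum>i=1..?n. 1 * \<bar>f (x i)\<bar>\<^sup>2) = (L2_set f (edges V))\<^sup>2" for f
      using sum.reindex_bij_betw[OF x, of "\<lambda>e. (f e)\<^sup>2"] by (simp add: L2_set_def sum_nonneg)
    then have "weighted_MZ (edges V) (F_complete V tail head) ?n x (\<lambda>_. 1) 0"
      using x by (auto simp: weighted_MZ_def bij_betw_def)
    moreover have "real m * 2 \<le> real m * (real m + 1)"
      using m by (intro mult_left_mono) auto
    then have "real ?n = MZ_lower_bound m 0"
      unfolding card by (simp add: MZ_lower_bound_def)
    ultimately show ?thesis by blast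
  qed
qed

end
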